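(* Let $S_0>0$ be a non-random initial stock price, $r$ the constant, continuously compounded interest rate, $T>0$ the maturity, $K>0$ the strike price, $H\in(3/4,1]$, $(\sigma,\epsilon)\neq(0,0)$ and $\lambda>0$. Let $(f_\gamma)_{\gamma\ge0}$ be a class of distortion functions and fix $\gamma\ge0$. On a probability space $(\Omega,\mathcal F,P)$ let $(W_t)_{t\ge0}$ be a standard Brownian motion and $(W^H_t)_{t\ge0}$ an independent standard fractional Brownian motion with Hurst index $H$. Let $(N(t))_{t\ge0}$ be a Poisson process with rate $\lambda$, $N(0)=0$, counting the jumps of the stock price, and let $(J_i)_{i\ge1}$ be an i.i.d. sequence of random variables, independent of the jump times, where the stock price is multiplied by $J_i$ at the $i$-th jump. Put $J(t)=\prod_{i=1}^{N(t)}J_i$ (with $J(t)=1$ if $N(t)=0$), and assume that the process $(J(t))_{t\ge0}$ is independent of $(W_t,W^H_t)_{t\ge0}$. Let $$\tilde S(T)=S_0\exp\Big(rT+\sigma W_T+\epsilon W^H_T-\tfrac12\sigma^2T-\tfrac12\epsilon^2T^{2H}\Big),\qquad S_T=\tilde S(T)J(T),$$ where $S_T$ is the stock price at time $T$, and let $F(x)=P(\tilde S(T)J(T)\le x)$. Then the bid price $b_\gamma(P)=e^{-rT}E_{f_\gamma}[(K-S_T)^+]$ and the ask price $a_\gamma(P)=-e^{-rT}E_{f_\gamma}[-(K-S_T)^+]$ of the European put option with payoff $(K-S_T)^+$ are given by $$b_\gamma(P)=-e^{-rT}\int_0^K (K-x)\,df_\gamma(1-F(x))=-e^{-rT}\int_0^K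 K\,df_\gamma(1-F(x))+e^{-rT}\int_0^K x\,df_\gamma(1-F(x)),$$ $$a_\gamma(P)=e^{-rT}\int_0^K (K-x)\,df_\gamma(F(x))=e^{-rT}\int_0^K K\,df_\gamma(F(x))-e^{-rT}\int_0^K x\,df_\gamma(F(x)).$$
   Context: A standard fractional Brownian motion with Hurst index $H\in(0,1]$ is an almost surely continuous centered Gaussian process $(W^H_t)$ with $\mathrm{Cov}(W^H_t,W^H_s)=\frac12(|t|^{2H}+|s|^{2H}-|t-s|^{2H})$. A distortion function is a nondecreasing $f:[0,1]\to[0,1]$ with $f(0)=0$ and $f(1)=1$. The distorted expectation of a random variable $X\in L^\infty(\Omega,\mathcal F,P)$ with distribution function $F_X$ under $P$ is $$E_f[X]=\int_0^\infty\big(1-f(P(X\le x))\big)\,dx-\int_{-\infty}^0 f(P(X\le x))\,dx=\int_{-\infty}^\infty x\,df(F_X(x)).$$ The index $\gamma$ of $f_\gamma$ quantifies the degree of distortion (the market liquidity level), and $\gamma=0$ means no distortion. An example of such a class is the WANG-transform $f_\gamma(u)=\Phi(\Phi^{-1}(u)+\gamma)$, with $\Phi$ the standard normal distribution function. For a cash flow $X$ at time $T$, the bid price is $b_\gamma(X)=\sup\{b:E_{f_\gamma}[e^{-rT}X-b]\ge0\}=e^{-rT}E_{f_\gamma}[X]$ and the ask price is $a_\gamma(X)=\inf\{a:E_{f_\gamma}[a-e^{-rT}X]\ge0\}=-e^{-rT}E_{f_\gamma}[-X]$. Integrals $\int h(x)\,dg(x)$ are Stieltjes integrals with respect to the monotone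 function $g$, which is nonincreasing for $g(x)=f_\gamma(1-F(x))$. $y^+=\max(y,0)$. In the symbols $b_\gamma(P)$, $a_\gamma(P)$ the letter $P$ denotes the put option; elsewhere $P$ is the probability measure. *)

theory Defs
  imports "HOL-Probability.Probability"
begin

section \<open>Distortion functions, distorted expectation, bid and ask prices\<close>

definition distortion_function :: "(real \<Rightarrow> real) \<Rightarrow> bool" where
  "distortion_function f \<longleftrightarrow>
     (\<forall>u\<in>{0..1}. f u \<in> {0..1}) \<and> mono_on {0..1} f \<and> f 0 = 0 \<and> f 1 = 1"

definition distortion_class :: "(real \<Rightarrow> real \<Rightarrow> real) \<Rightarrow> bool" where
  "distortion_class f \<longleftrightarrow>
     (\<forall>\<gamma>\<ge>0. distortion_function (f \<gamma>)) \<and> (\<forall>u\<in>{0..1}. f 0 u = u)"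

definition L_inf :: "'a measure \<Rightarrow> ('a \<Rightarrow> real) set" where
  "L_inf M = {X \<in> borel_measurable M. \<exists>C. AE \<omega> in M. \<bar>X \<omega>\<bar> \<le> C}"

text \<open>Meaningful for \<open>X \<in> L_inf M\<close> only; otherwise an integral below may diverge, and its
  value is then the default 0.\<close>

definition distorted_expectation :: "'a measure \<Rightarrow> (real \<Rightarrow> real) \<Rightarrow> ('a \<Rightarrow> real) \<Rightarrow> real" where
  "distorted_expectation M f X =
     (LBINT x:{0..}. 1 - f (measure M {\<omega> \<in> space M. X \<omega> \<le> x}))
     - (LBINT x:{..0}. f (measure M {\<omega> \<in> space M. X \<omega> \<le> x}))"

definition bid_price ::
  "'a measure \<Rightarrow> (real \<Rightarrow> real) \<Rightarrow> real \<Rightarrow> real \<Rightarrow> ('a \<Rightarrow> real) \<Rightarrow> real" where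
  "bid_price M f r T X =
     Sup {b. distorted_expectation M f (\<lambda>\<omega>. exp (- r * T) * X \<omega> - b) \<ge> 0}"

definition ask_price ::
  "'a measure \<Rightarrow> (real \<Rightarrow> real) \<Rightarrow> real \<Rightarrow> real \<Rightarrow> ('a \<Rightarrow> real) \<Rightarrow> real" where
  "ask_price M f r T X =
     Inf {a. distorted_expectation M f (\<lambda>\<omega>. a - exp (- r * T) * X \<omega>) \<ge> 0}"


section \<open>Stieltjes integral with respect to a monotone function\<close>

text \<open>Lebesgue-Stieltjes integral over the closed interval \<open>{a..b}\<close>. The integrator \<open>g\<close> is a
  monotone function on the whole real line that need not be one-sided continuous, so its measure
  is the one of the right-continuous modification \<open>x \<mapsto> g(x+)\<close>: a point \<open>x\<close>, also \<open>x = a\<close> or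
  \<open>x = b\<close>, carries the mass \<open>g(x+) - g(x-)\<close>. A nonincreasing \<open>g\<close> gives the negative measure of
  \<open>-g\<close>.\<close>

definition right_lim :: "(real \<Rightarrow> real) \<Rightarrow> real \<Rightarrow> real" where
  "right_lim g x = Lim (at_right x) g"

definition stieltjes_integral ::
  "real \<Rightarrow> real \<Rightarrow> (real \<Rightarrow> real) \<Rightarrow> (real \<Rightarrow> real) \<Rightarrow> real" where
  "stieltjes_integral a b h g =
     (if mono g then (LINT x:{a..b}|interval_measure (right_lim g). h x)
      else - (LINT x:{a..b}|interval_measure (right_lim (\<lambda>y. - g y)). h x))"


section \<open>Stochastic processes indexed by nonnegative times\<close>

definition independent_increments :: "'a measure \<Rightarrow> (real \<Rightarrow> 'a \<Rightarrow> real) \<Rightarrow> bool" where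
  "independent_increments M X \<longleftrightarrow>
     (\<forall>n (t :: nat \<Rightarrow> real). 0 \<le> t 0 \<and> (\<forall>i<n. t i \<le> t (Suc i)) \<longrightarrow>
        prob_space.indep_vars M (\<lambda>_. borel) (\<lambda>i \<omega>. X (t (Suc i)) \<omega> - X (t i) \<omega>) {..<n})"

definition standard_brownian_motion :: "'a measure \<Rightarrow> (real \<Rightarrow> 'a \<Rightarrow> real) \<Rightarrow> bool" where
  "standard_brownian_motion M W \<longleftrightarrow>
     (\<forall>t\<ge>0. W t \<in> borel_measurable M) \<and>
     (AE \<omega> in M. W 0 \<omega> = 0) \<and>
     independent_increments M W \<and>
     (\<forall>s t. 0 \<le> s \<and> s < t \<longrightarrow>
        distributed M lborel (\<lambda>\<omega>. W t \<omega> - W s \<omega>) (normal_density 0 (sqrt (t - s)))) \<and>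
     (AE \<omega> in M. continuous_on {0..} (\<lambda>t. W t \<omega>))"

text \<open>Constants count as Gaussian.\<close>

definition gaussian_rv :: "'a measure \<Rightarrow> ('a \<Rightarrow> real) \<Rightarrow> bool" where
  "gaussian_rv M X \<longleftrightarrow> X \<in> borel_measurable M \<and>
     ((\<exists>m. AE \<omega> in M. X \<omega> = m) \<or>
      (\<exists>m s. s > 0 \<and> distributed M lborel X (normal_density m s)))"

definition gaussian_process :: "'a measure \<Rightarrow> (real \<Rightarrow> 'a \<Rightarrow> real) \<Rightarrow> bool" where
  "gaussian_process M X \<longleftrightarrow>
     (\<forall>A (c :: real \<Rightarrow> real). finite A \<and> A \<subseteq> {0..} \<longrightarrow>
        gaussian_rv M (\<lambda>\<omega>. \<Sum>t\<in>A. c t * X t \<omega>))"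

definition covariance :: "'a measure \<Rightarrow> ('a \<Rightarrow> real) \<Rightarrow> ('a \<Rightarrow> real) \<Rightarrow> real" where
  "covariance M X Y =
     (LINT \<omega>|M. (X \<omega> - (LINT \<omega>'|M. X \<omega>')) * (Y \<omega> - (LINT \<omega>'|M. Y \<omega>')))"

definition fractional_brownian_motion ::
  "'a measure \<Rightarrow> real \<Rightarrow> (real \<Rightarrow> 'a \<Rightarrow> real) \<Rightarrow> bool" where
  "fractional_brownian_motion M H X \<longleftrightarrow>
     gaussian_process M X \<and>
     (\<forall>t\<ge>0. (LINT \<omega>|M. X t \<omega>) = 0) \<and>
     (\<forall>t\<ge>0. \<forall>s\<ge>0. covariance M (X t) (X s) =
        (\<bar>t\<bar> powr (2 * H) + \<bar>s\<bar> powr (2 * H) - \<bar>t - s\<bar> powr (2 * H)) / 2) \<and>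
     (AE \<omega> in M. continuous_on {0..} (\<lambda>t. X t \<omega>))"

definition poisson_process :: "'a measure \<Rightarrow> real \<Rightarrow> (real \<Rightarrow> 'a \<Rightarrow> nat) \<Rightarrow> bool" where
  "poisson_process M rate N \<longleftrightarrow>
     (\<forall>t\<ge>0. N t \<in> measurable M (count_space UNIV)) \<and>
     (AE \<omega> in M. N 0 \<omega> = 0) \<and>
     independent_increments M (\<lambda>t \<omega>. real (N t \<omega>)) \<and>
     (\<forall>s t k. 0 \<le> s \<and> s < t \<longrightarrow>
        measure M {\<omega> \<in> space M. N t \<omega> = N s \<omega> + k} = pmf (poisson_pmf (rate * (t - s))) k) \<and>
     (AE \<omega> in M. mono_on {0..} (\<lambda>t. N t \<omega>) \<and>
        (\<forall>t\<ge>0. continuous (at_right t) (\<lambda>s. real (N s \<omega>))))"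

text \<open>Time of the \<open>n\<close>-th jump; for a Poisson process with positive rate the set is almost surely
  nonempty.\<close>

definition jump_time :: "(real \<Rightarrow> 'a \<Rightarrow> nat) \<Rightarrow> nat \<Rightarrow> 'a \<Rightarrow> real" where
  "jump_time N n \<omega> = Inf {t. 0 \<le> t \<and> n \<le> N t \<omega>}"

definition jump_factor :: "(real \<Rightarrow> 'a \<Rightarrow> nat) \<Rightarrow> (nat \<Rightarrow> 'a \<Rightarrow> real) \<Rightarrow> real \<Rightarrow> 'a \<Rightarrow> real" where
  "jump_factor N J t \<omega> = (\<Prod>i=1..N t \<omega>. J i \<omega>)"

text \<open>Each family is taken as one random variable with values in the product space. Since
  \<open>indep_var\<close> requires both variables to have the same value type, independence is stated for the
  generated sigma-algebras.\<close>

definition independent_families ::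
  "'a measure \<Rightarrow> 'i set \<Rightarrow> ('i \<Rightarrow> 'a \<Rightarrow> 'b::topological_space) \<Rightarrow>
     'j set \<Rightarrow> ('j \<Rightarrow> 'a \<Rightarrow> 'c::topological_space) \<Rightarrow> bool" where
  "independent_families M I X I' Y \<longleftrightarrow>
     (\<forall>i\<in>I. X i \<in> borel_measurable M) \<and> (\<forall>j\<in>I'. Y j \<in> borel_measurable M) \<and>
     prob_space.indep_set M
       {(\<lambda>\<omega>. \<lambda>i\<in>I. X i \<omega>) -` A \<inter> space M | A. A \<in> sets (Pi\<^sub>M I (\<lambda>_. borel))}
       {(\<lambda>\<omega>. \<lambda>j\<in>I'. Y j \<omega>) -` A \<inter> space M | A. A \<in> sets (Pi\<^sub>M I' (\<lambda>_. borel))}"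

definition iid_sequence :: "'a measure \<Rightarrow> (nat \<Rightarrow> 'a \<Rightarrow> real) \<Rightarrow> bool" where
  "iid_sequence M J \<longleftrightarrow>
     prob_space.indep_vars M (\<lambda>_. borel) J {1..} \<and>
     (\<forall>i\<ge>1. distr M borel (J i) = distr M borel (J 1))"

end

theory Submission
  imports Defs
begin

text \<open>For bounded \<open>X\<close> with distorted distribution function \<open>G x = f (P(X \<le> x))\<close>, the distorted expectation
  is the single integral of \<open>indicator {0..} - G\<close>, and the affine substitution there gives cash
  invariance and positive homogeneity, hence the bid and ask formulas. The payoff of the put is bounded
  only if the jump factor is almost surely nonnegative, since the independent continuous part of the
  price is unbounded; so the price is nonnegative and all integrals live on \<open>{0..K}\<close>. There the
  Stieltjes integrals of \<open>K - x\<close> become Lebesgue integrals of the integrator by Fubini's theorem, and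
  one-sided limits do not matter because a monotone function has only countably many discontinuities.\<close>

section \<open>Stieltjes integrals\<close>

text \<open>\<open>Lim\<close> in \<open>right_lim\<close> has its intended meaning only where a
  limit exists. For monotone \<open>g\<close> it does: the values to the right of \<open>x\<close>
  are bounded below by \<open>g x\<close> and decrease to their infimum.\<close>

lemma mono_tendsto_right_lim:
  assumes "mono g"
  shows "(g \<longlongrightarrow> right_lim g x) (at_right x)"
proof -
  have "(g \<longlongrightarrow> Inf (g ` ({x<..} \<inter> UNIV))) (at x within ({x<..} \<inter> UNIV))"
    by (rule Lim_right_bound[where K = "g x"]) (use assms in \<open>auto simp: mono_def\<close>)
  then have L: "(g \<longlongrightarrow> Inf (g ` {x<..})) (at_right x)" by simp
  then have "right_lim g x = Inf (g ` {x<..})"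
    unfolding right_lim_def by (intro tendsto_Lim) auto
  with L show ?thesis by simp
qed

lemma right_lim_le:
  assumes "mono g" "x < y"
  shows "right_lim g x \<le> g y"
proof (rule tendsto_upperbound[OF mono_tendsto_right_lim[OF assms(1)]])
  show "\<forall>\<^sub>F z in at_right x. g z \<le> g y"
    using eventually_at_right_less[of x] eventually_at_right[OF assms(2)] assms
    by (auto simp: mono_def intro!: exI[of _ y])
qed simp

lemma right_lim_ge:
  assumes "mono g"
  shows "g x \<le> right_lim g x"
proof (rule tendsto_lowerbound[OF mono_tendsto_right_lim[OF assms(1)]])
  show "\<forall>\<^sub>F z in at_right x. g x \<le> g z"
    using eventually_at_right_less[of x]
    by eventually_elim (use assms in \<open>auto simp: mono_def\<close>)
qed simp

lemma mono_right_lim: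
  assumes "mono g"
  shows "mono (right_lim g)"
proof (rule monoI)
  fix x y :: real assume "x \<le> y"
  then show "right_lim g x \<le> right_lim g y"
    using right_lim_le[OF assms, of x y] right_lim_ge[OF assms, of y]
    by (cases "x = y") auto
qed

text \<open>Together with monotonicity, this is what makes
  \<open>interval_measure (right_lim g)\<close> give \<open>{u<..v}\<close> the mass
  \<open>right_lim g v - right_lim g u\<close>.\<close>

lemma right_continuous_right_lim:
  assumes "mono g"
  shows "continuous (at_right x) (right_lim g)"
  unfolding continuous_within
proof (rule order_tendstoI)
  fix a assume a: "a < right_lim g x"
  show "\<forall>\<^sub>F y in at_right x. a < right_lim g y"
    using eventually_at_right_less[of x]
    by eventually_elim (use a mono_right_lim[OF assms] in \<open>auto simp: mono_def intro: less_le_trans\<close>)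
next
  fix a assume "right_lim g x < a"
  then have "\<forall>\<^sub>F y in at_right x. g y < a"
    using mono_tendsto_right_lim[OF assms] by (rule order_tendstoD[rotated])
  then obtain b where b: "b > x" "\<And>y. x < y \<Longrightarrow> y < b \<Longrightarrow> g y < a"
    by (auto simp: eventually_at_right_field)
  show "\<forall>\<^sub>F y in at_right x. right_lim g y < a"
    unfolding eventually_at_right_field
  proof (intro exI conjI allI impI)
    fix y assume y: "x < y" "y < b"
    \<comment> \<open>The midpoint of \<open>y\<close> and \<open>b\<close> is strictly to the right
      of \<open>y\<close>, so it dominates the right limit at \<open>y\<close>, and it still lies
      where \<open>g\<close> is below \<open>a\<close>.\<close>
    have "right_lim g y \<le> g ((y + b) / 2)"
      using right_lim_le[OF assms, of y "(y + b) / 2"] y by simp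
    also have "\<dots> < a" using b y by simp
    finally show "right_lim g y < a" .
  qed (use b in auto)
qed

text \<open>The two functions agree wherever \<open>g\<close> is continuous, and a monotone function
  has only countably many discontinuities.\<close>

lemma AE_right_lim_eq:
  assumes "mono g"
  shows "AE x in lborel. right_lim g x = g x"
proof -
  have "right_lim g x = g x" if "isCont g x" for x
  proof -
    have "(g \<longlongrightarrow> g x) (at_right x)"
      using that by (auto simp: isCont_def intro: filterlim_mono at_le)
    then show ?thesis unfolding right_lim_def by (intro tendsto_Lim) auto
  qed
  then show ?thesis
    by (intro AE_I'[OF countable_imp_null_set_lborel[OF mono_ctble_discont[OF assms]]]) auto
qed

text \<open>Since \<open>g\<close> equals \<open>c\<close> to the left of \<open>a\<close>, the
  constant \<open>c\<close> is the left limit at \<open>a\<close>, so a possible atom at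
  \<open>a\<close> is included in the mass. The open gap \<open>{a - 1<..<a}\<close> is null because
  half-open intervals without mass exhaust it.\<close>

lemma emeasure_interval_measure_right_lim_Icc:
  assumes "mono g" and const: "\<And>x. x < a \<Longrightarrow> g x = c" and "a \<le> y"
  shows "emeasure (interval_measure (right_lim g)) {a..y} = ennreal (right_lim g y - c)"
proof -
  let ?\<mu> = "interval_measure (right_lim g)"
  note Ioc = emeasure_interval_measure_Ioc[OF _ monoD[OF mono_right_lim[OF assms(1)]]
      right_continuous_right_lim[OF assms(1)]]
  have lim: "right_lim g x = c" if "x < a" for x
    using right_lim_le[OF assms(1), of x "(x + a) / 2"] right_lim_ge[OF assms(1), of x]
      const[of x] const[of "(x + a) / 2"] that by auto
  have "{a - 1<..a - 1 / real (Suc n)} \<in> null_sets ?\<mu>" for n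
    by (auto intro!: null_setsI simp: Ioc lim field_simps)
  then have "(\<Union>n. {a - 1<..a - 1 / real (Suc n)}) \<in> null_sets ?\<mu>" by blast
  moreover have "(\<Union>n. {a - 1<..a - 1 / real (Suc n)}) = {a - 1<..<a}"
  proof (intro set_eqI iffI)
    fix x assume "x \<in> {a - 1<..<a}"
    then obtain n where "inverse (real (Suc n)) < a - x" using reals_Archimedean[of "a - x"] by auto
    with \<open>x \<in> {a - 1<..<a}\<close> show "x \<in> (\<Union>n. {a - 1<..a - 1 / real (Suc n)})"
      by (auto simp: inverse_eq_divide intro!: exI[of _ n])
  next
    fix x assume "x \<in> (\<Union>n. {a - 1<..a - 1 / real (Suc n)})"
    then obtain n where "a - 1 < x" and x: "x \<le> a - 1 / real (Suc n)" by auto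
    note x
    also have "a - 1 / real (Suc n) < a" by simp
    finally show "x \<in> {a - 1<..<a}" using \<open>a - 1 < x\<close> by simp
  qed
  ultimately have null: "{a - 1<..<a} \<in> null_sets ?\<mu>" by simp
  have "{a..y} = {a - 1<..y} - {a - 1<..<a}" using \<open>a \<le> y\<close> by auto
  then have "emeasure ?\<mu> {a..y} = emeasure ?\<mu> {a - 1<..y}"
    using emeasure_Diff_null_set[OF null, of "{a - 1<..y}"] by simp
  also have "\<dots> = ennreal (right_lim g y - right_lim g (a - 1))"
    using \<open>a \<le> y\<close> by (intro Ioc) auto
  finally show ?thesis by (simp add: lim)
qed

text \<open>Integration by parts: write \<open>b - x\<close> as the length of \<open>{x..b}\<close> and exchange the integrals.\<close>

lemma integral_interval_measure_linear:
  assumes "mono g" and const: "\<And>x. x < a \<Longrightarrow> g x = c"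
  shows "(LINT x:{a..b}|interval_measure (right_lim g). b - x) = (LBINT y:{a..b}. g y - c)"
proof -
  let ?\<mu> = "interval_measure (right_lim g)"
  interpret \<mu>: sigma_finite_measure ?\<mu>
    using sigma_finite_interval_measure[OF monoD[OF mono_right_lim[OF assms(1)]]
        right_continuous_right_lim[OF assms(1)]] .
  interpret pair_sigma_finite ?\<mu> lborel ..
  have c: "c \<le> g y" if "y \<ge> a" for y
    using const[of "a - 1"] monoD[OF assms(1), of "a - 1" y] that by simp
  have [measurable]: "g \<in> borel_measurable borel" using assms(1) by (rule borel_measurable_mono)
  \<comment> \<open>The double integral runs over the triangle of points with
    \<open>a \<le> x \<le> y \<le> b\<close>; its section at fixed \<open>x\<close> is
    \<open>{x..b}\<close>, at fixed \<open>y\<close> it is \<open>{a..y}\<close>.\<close>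
  have "(\<integral>\<^sup>+x. ennreal (indicator {a..b} x * (b - x)) \<partial>?\<mu>)
      = (\<integral>\<^sup>+x. \<integral>\<^sup>+y. indicator {p. a \<le> fst p \<and> fst p \<le> snd p \<and> snd p \<le> b} (x, y) \<partial>lborel \<partial>?\<mu>)"
  proof (rule nn_integral_cong)
    fix x
    have "(\<integral>\<^sup>+y. indicator {p. a \<le> fst p \<and> fst p \<le> snd p \<and> snd p \<le> b} (x, y) \<partial>lborel)
        = (\<integral>\<^sup>+y. indicator {y. a \<le> x \<and> x \<le> y \<and> y \<le> b} y \<partial>lborel)"
      by (intro nn_integral_cong) (auto split: split_indicator)
    also have "\<dots> = emeasure lborel {y. a \<le> x \<and> x \<le> y \<and> y \<le> b}" by simp
    also have "{y. a \<le> x \<and> x \<le> y \<and> y \<le> b} = (if a \<le> x \<and> x \<le> b then {x..b} else {})" by auto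
    also have "emeasure lborel \<dots> = ennreal (indicator {a..b} x * (b - x))"
      by (auto split: split_indicator)
    finally show "ennreal (indicator {a..b} x * (b - x)) =
      (\<integral>\<^sup>+y. indicator {p. a \<le> fst p \<and> fst p \<le> snd p \<and> snd p \<le> b} (x, y) \<partial>lborel)" by simp
  qed
  also have "\<dots> = (\<integral>\<^sup>+y. \<integral>\<^sup>+x. indicator {p. a \<le> fst p \<and> fst p \<le> snd p \<and> snd p \<le> b} (x, y) \<partial>?\<mu> \<partial>lborel)"
    by (rule Fubini'[symmetric]) measurable
  \<comment> \<open>The section has mass \<open>right_lim g y - c\<close>, which may be replaced by
    \<open>g y - c\<close> only for almost every \<open>y\<close>.\<close>
  also have "\<dots> = (\<integral>\<^sup>+y. ennreal (indicator {a..b} y * (g y - c)) \<partial>lborel)"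
  proof (rule nn_integral_cong_AE, use AE_right_lim_eq[OF assms(1)] in eventually_elim)
    fix y assume y: "right_lim g y = g y"
    have "(\<integral>\<^sup>+x. indicator {p. a \<le> fst p \<and> fst p \<le> snd p \<and> snd p \<le> b} (x, y) \<partial>?\<mu>)
        = (\<integral>\<^sup>+x. indicator {x. a \<le> x \<and> x \<le> y \<and> y \<le> b} x \<partial>?\<mu>)"
      by (intro nn_integral_cong) (auto split: split_indicator)
    also have "\<dots> = emeasure ?\<mu> {x. a \<le> x \<and> x \<le> y \<and> y \<le> b}" by simp
    also have "{x. a \<le> x \<and> x \<le> y \<and> y \<le> b} = (if a \<le> y \<and> y \<le> b then {a..y} else {})" by auto
    also have "emeasure ?\<mu> \<dots> = ennreal (indicator {a..b} y * (g y - c))"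
      using emeasure_interval_measure_right_lim_Icc[OF assms(1) const] y by (simp split: split_indicator)
    finally show "(\<integral>\<^sup>+x. indicator {p. a \<le> fst p \<and> fst p \<le> snd p \<and> snd p \<le> b} (x, y) \<partial>?\<mu>)
      = ennreal (indicator {a..b} y * (g y - c))" .
  qed
  finally show ?thesis
    unfolding set_lebesgue_integral_def
    by (subst (1 2) integral_eq_nn_integral) (auto intro!: AE_I2 simp: c split: split_indicator)
qed

section \<open>Integrability and linearity of Stieltjes integrals\<close>

lemma set_integrable_interval_measure_right_lim:
  fixes h :: "real \<Rightarrow> real"
  assumes "mono g" and "continuous_on {a..b} h"
  shows "set_integrable (interval_measure (right_lim g)) {a..b} h"
proof -
  let ?\<mu> = "interval_measure (right_lim g)"
  have "bounded (h ` {a..b})"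
    using assms by (intro compact_imp_bounded compact_continuous_image) auto
  then have "\<exists>B. \<forall>x\<in>{a..b}. \<bar>h x\<bar> \<le> B" by (simp add: bounded_iff)
  then obtain B where B: "\<And>x. x \<in> {a..b} \<Longrightarrow> \<bar>h x\<bar> \<le> B" by blast
  \<comment> \<open>Subtracting 1 makes the half-open interval contain the point \<open>a\<close>;
    the minimum keeps its endpoints ordered when \<open>b < a\<close>.\<close>
  have "emeasure ?\<mu> {a..b} \<le> emeasure ?\<mu> {min a b - 1<..b}"
    by (intro emeasure_mono) auto
  also have "\<dots> < \<infinity>"
    using emeasure_interval_measure_Ioc[OF _ monoD[OF mono_right_lim[OF assms(1)]]
      right_continuous_right_lim[OF assms(1)], of "min a b - 1" b] by simp
  finally have fin: "emeasure ?\<mu> {a..b} < \<infinity>" .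
  show ?thesis unfolding set_integrable_def
  proof (rule integrableI_bounded_set[where A = "{a..b}" and B = B])
    show "(\<lambda>x. indicator {a..b} x *\<^sub>R h x) \<in> borel_measurable ?\<mu>"
      using borel_measurable_continuous_on_indicator[of "{a..b}" h] assms
      by (simp cong: measurable_cong_sets)
  qed (use fin B in auto)
qed

lemma stieltjes_integral_diff:
  assumes "mono g \<or> antimono g" "continuous_on {a..b} h" "continuous_on {a..b} k"
  shows "stieltjes_integral a b (\<lambda>x. h x - k x) g
       = stieltjes_integral a b h g - stieltjes_integral a b k g"
proof (cases "mono g")
  case True
  then show ?thesis
    using assms by (simp add: stieltjes_integral_def set_integral_diff
        set_integrable_interval_measure_right_lim)
next
  case False
  then have "mono (\<lambda>x. - g x)" using assms by (auto simp: monotone_def)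
  then show ?thesis
    using assms False by (simp add: stieltjes_integral_def set_integral_diff
        set_integrable_interval_measure_right_lim)
qed

lemma stieltjes_integral_mono_linear:
  assumes "mono g" and "\<And>x. x < a \<Longrightarrow> g x = c"
  shows "stieltjes_integral a b (\<lambda>x. b - x) g = (LBINT y:{a..b}. g y - c)"
  using integral_interval_measure_linear[OF assms] assms(1) by (simp add: stieltjes_integral_def)

text \<open>The monotone case applies to \<open>- g\<close>. A constant \<open>g\<close> is the
  exception: it is monotone as well, so the definition takes its first branch, and both sides are
  0.\<close>

lemma stieltjes_integral_antimono_linear:
  assumes "antimono g" and const: "\<And>x. x < a \<Longrightarrow> g x = c"
  shows "stieltjes_integral a b (\<lambda>x. b - x) g = - (LBINT y:{a..b}. c - g y)"
proof (cases "mono g")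
  case True
  have "g y = c" for y
  proof (rule antisym)
    have m: "min y a - 1 \<le> y" "min y a - 1 < a" by auto
    show "g y \<le> c" using antimonoD[OF assms(1) m(1)] const[OF m(2)] by simp
    show "c \<le> g y" using monoD[OF True m(1)] const[OF m(2)] by simp
  qed
  then show ?thesis
    using stieltjes_integral_mono_linear[OF True, of a c b] by simp
next
  case False
  have "mono (\<lambda>x. - g x)" using assms by (auto simp: monotone_def)
  from integral_interval_measure_linear[OF this, of a "- c" b] False show ?thesis
    by (simp add: stieltjes_integral_def const)
qed

section \<open>Distorted expectation of bounded random variables\<close>

lemma distortion_functionD:
  assumes "distortion_function f"
  shows "f 0 = 0" "f 1 = 1" "0 \<le> u \<Longrightarrow> u \<le> v \<Longrightarrow> v \<le> 1 \<Longrightarrow> f u \<le> f v"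
    "0 \<le> u \<Longrightarrow> u \<le> 1 \<Longrightarrow> 0 \<le> f u" "0 \<le> u \<Longrightarrow> u \<le> 1 \<Longrightarrow> f u \<le> 1"
  using assms by (auto simp: distortion_function_def mono_on_def)

text \<open>The integrand is the signed indicator of the interval between 0 and \<open>d\<close>. It
  measures the effect of adding cash to a payoff.\<close>

lemma has_bochner_integral_indicator_shift:
  fixes d :: real
  shows "has_bochner_integral lborel (\<lambda>x. indicator {d..} x - indicator {0..} x) (- d)"
proof (cases "0 \<le> d")
  case True
  have "has_bochner_integral lborel (\<lambda>x. - indicator {0..<d} x) (- d)"
    using has_bochner_integral_minus[OF has_bochner_integral_real_indicator[of "{0..<d}" lborel]] True
    by simp
  moreover have "(\<lambda>x. - indicator {0..<d} x) = (\<lambda>x. indicator {d..} x - indicator {0..} x :: real)"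
    using True by (auto split: split_indicator)
  ultimately show ?thesis by simp
next
  case False
  have "has_bochner_integral lborel (indicator {d..<0}) (- d)"
    using has_bochner_integral_real_indicator[of "{d..<0}" lborel] False by simp
  moreover have "indicator {d..<0} = (\<lambda>x. indicator {d..} x - indicator {0..} x :: real)"
    using False by (auto split: split_indicator)
  ultimately show ?thesis by simp
qed

context prob_space
begin

section \<open>Distorted distribution functions\<close>

lemma mono_distorted_cdf:
  fixes X :: "'a \<Rightarrow> real"
  assumes "distortion_function f" and [measurable]: "X \<in> borel_measurable M"
  shows "mono (\<lambda>x. f (prob {\<omega> \<in> space M. X \<omega> \<le> x}))"
  by (intro monoI distortion_functionD(3)[OF assms(1)] finite_measure_mono) auto

text \<open>Measurability comes from monotonicity of the composition, as \<open>f\<close> carries no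
  measurability assumption.\<close>

lemma borel_measurable_distorted_cdf:
  fixes X :: "'a \<Rightarrow> real"
  assumes "distortion_function f" "X \<in> borel_measurable M"
  shows "(\<lambda>x. f (prob {\<omega> \<in> space M. X \<omega> \<le> x})) \<in> borel_measurable borel"
  by (intro borel_measurable_mono mono_distorted_cdf assms)

lemma distorted_cdf_bounds:
  assumes "distortion_function f"
  shows "0 \<le> f (prob A)" "f (prob A) \<le> 1"
  using distortion_functionD(4,5)[OF assms, of "prob A"] by auto

lemma distorted_cdf_eq_0:
  fixes X :: "'a \<Rightarrow> real"
  assumes "distortion_function f" "AE \<omega> in M. A \<le> X \<omega>" "x < A"
  shows "f (prob {\<omega> \<in> space M. X \<omega> \<le> x}) = 0"
proof -
  have "prob {\<omega> \<in> space M. X \<omega> \<le> x} = 0"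
    by (rule prob_eq_0_AE, use assms(2) in eventually_elim) (use assms(3) in auto)
  then show ?thesis using distortion_functionD(1)[OF assms(1)] by simp
qed

lemma distorted_cdf_eq_1:
  fixes X :: "'a \<Rightarrow> real"
  assumes "distortion_function f" and [measurable]: "X \<in> borel_measurable M"
    and "AE \<omega> in M. X \<omega> \<le> B" "B \<le> x"
  shows "f (prob {\<omega> \<in> space M. X \<omega> \<le> x}) = 1"
proof -
  have "AE \<omega> in M. X \<omega> \<le> x" using assms(3) by eventually_elim (use assms(4) in auto)
  then have "prob {\<omega> \<in> space M. X \<omega> \<le> x} = 1" by (subst prob_Collect_eq_1) auto
  then show ?thesis using distortion_functionD(2)[OF assms(1)] by simp
qed

lemma
  fixes X :: "'a \<Rightarrow> real"
  assumes f: "distortion_function f" and X [measurable]: "X \<in> borel_measurable M"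
    and bounds: "AE \<omega> in M. A \<le> X \<omega>" "AE \<omega> in M. X \<omega> \<le> B"
  defines "G \<equiv> \<lambda>x. f (prob {\<omega> \<in> space M. X \<omega> \<le> x})"
  shows integrable_indicator_minus_distorted_cdf:
      "integrable lborel (\<lambda>x. indicator {0..} x - G x)" (is ?I)
    and distorted_expectation_eq_integral:
      "distorted_expectation M f X = (LBINT x. indicator {0..} x - G x)" (is ?E)
proof -
  have [measurable]: "G \<in> borel_measurable borel"
    unfolding G_def by (rule borel_measurable_distorted_cdf[OF f X])
  have G: "\<bar>G x\<bar> \<le> 1" "\<bar>1 - G x\<bar> \<le> 1" for x
    using distorted_cdf_bounds[OF f] unfolding G_def by (auto simp: abs_le_iff)
  \<comment> \<open>\<open>G\<close> is 1 from \<open>B\<close> on and 0 below \<open>A\<close>, so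
    both integrands are bounded with bounded support.\<close>
  have "(\<lambda>x. indicator {0..} x * (1 - G x)) = (\<lambda>x. indicator {0..B} x *\<^sub>R (1 - G x))"
    using distorted_cdf_eq_1[OF f X bounds(2)] by (force simp: G_def split: split_indicator)
  moreover have "integrable lborel \<dots>"
    by (rule integrableI_bounded_set_indicator[where B = 1]) (use G in \<open>auto simp: emeasure_lborel_Icc_eq\<close>)
  ultimately have 1: "integrable lborel (\<lambda>x. indicator {0..} x * (1 - G x))" by simp
  have "(\<lambda>x. indicator {..0} x * G x) = (\<lambda>x. indicator {A..0} x *\<^sub>R G x)"
    using distorted_cdf_eq_0[OF f bounds(1)] by (force simp: G_def split: split_indicator)
  moreover have "integrable lborel \<dots>"
    by (rule integrableI_bounded_set_indicator[where B = 1]) (use G in \<open>auto simp: emeasure_lborel_Icc_eq\<close>)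
  ultimately have 2: "integrable lborel (\<lambda>x. indicator {..0} x * G x)" by simp
  \<comment> \<open>The point 0 belongs to both half-lines of the definition, so the integrands
    merge only off that point.\<close>
  have AE: "AE x in lborel. indicator {0..} x * (1 - G x) - indicator {..0} x * G x
      = indicator {0..} x - G x"
    using AE_lborel_singleton[of "0::real"] by eventually_elim (auto split: split_indicator)
  show ?I
    using Bochner_Integration.integrable_diff[OF 1 2] by (rule integrable_cong_AE_imp) (use AE in auto)
  have "distorted_expectation M f X
      = (LBINT x. indicator {0..} x * (1 - G x)) - (LBINT x. indicator {..0} x * G x)"
    by (simp add: distorted_expectation_def set_lebesgue_integral_def G_def)
  also have "\<dots> = (LBINT x. indicator {0..} x * (1 - G x) - indicator {..0} x * G x)"
    using 1 2 by simp
  also have "\<dots> = (LBINT x. indicator {0..} x - G x)"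
    by (rule integral_cong_AE) (use AE in auto)
  finally show ?E .
qed

text \<open>Substituting \<open>b + c * x\<close> for the integration variable turns the event for
  \<open>c * X + b\<close> back into \<open>X \<le> x\<close>; the factor \<open>c\<close> is the
  Jacobian.\<close>

lemma distorted_expectation_affine:
  assumes f: "distortion_function f" and X: "X \<in> L_inf M" and "0 < c"
  shows "distorted_expectation M f (\<lambda>\<omega>. c * X \<omega> + b) = c * distorted_expectation M f X + b"
proof -
  obtain C where X [measurable]: "X \<in> borel_measurable M" and C: "AE \<omega> in M. \<bar>X \<omega>\<bar> \<le> C"
    using X by (auto simp: L_inf_def)
  let ?G = "\<lambda>x. f (prob {\<omega> \<in> space M. X \<omega> \<le> x})"
  have X_bounds: "AE \<omega> in M. - C \<le> X \<omega>" "AE \<omega> in M. X \<omega> \<le> C"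
    using C by (auto elim!: eventually_mono)
  have Y_bounds: "AE \<omega> in M. c * - C + b \<le> c * X \<omega> + b" "AE \<omega> in M. c * X \<omega> + b \<le> c * C + b"
    by (rule eventually_mono[OF X_bounds(1)], rule add_right_mono, rule mult_left_mono;
        use \<open>0 < c\<close> in simp)
      (rule eventually_mono[OF X_bounds(2)], rule add_right_mono, rule mult_left_mono;
        use \<open>0 < c\<close> in simp)
  have iff: "c * X \<omega> + b \<le> b + c * x \<longleftrightarrow> X \<omega> \<le> x" for \<omega> x
    using \<open>0 < c\<close> by simp
  \<comment> \<open>Only the step of the indicator has moved, from 0 to \<open>- b / c\<close>. The
    last bracket therefore integrates to \<open>b / c\<close>, which becomes \<open>b\<close> after
    multiplication by \<open>c\<close>.\<close>
  have ind: "indicator {0..} (b + c * x) - ?G x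
      = (indicator {0..} x - ?G x) + (indicator {- b / c..} x - indicator {0..} x)" for x :: real
    using \<open>0 < c\<close> by (auto split: split_indicator simp: field_simps)
  have "distorted_expectation M f (\<lambda>\<omega>. c * X \<omega> + b)
      = (LBINT x. indicator {0..} x - f (prob {\<omega> \<in> space M. c * X \<omega> + b \<le> x}))"
    by (rule distorted_expectation_eq_integral[OF f _ Y_bounds]) simp
  also have "\<dots> = c * (LBINT x. indicator {0..} (b + c * x) - ?G x)"
    using \<open>0 < c\<close> by (subst lborel_integral_real_affine[of c _ b]) (simp_all add: iff)
  also have "(LBINT x. indicator {0..} (b + c * x) - ?G x) = distorted_expectation M f X + - (- b / c)"
    unfolding ind distorted_expectation_eq_integral[OF f X X_bounds]
    by (subst Bochner_Integration.integral_add)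
      (use integrable_indicator_minus_distorted_cdf[OF f X X_bounds]
        has_bochner_integral_indicator_shift[of "- b / c"] in
        \<open>auto simp: has_bochner_integral_iff\<close>)
  finally show ?thesis using \<open>0 < c\<close> by (simp add: distrib_left)
qed

text \<open>By cash invariance the acceptable values of \<open>b\<close> form a closed half-line,
  and the supremum is its endpoint.\<close>

lemma bid_price_eq:
  assumes "distortion_function f" "X \<in> L_inf M"
  shows "bid_price M f r T X = exp (- r * T) * distorted_expectation M f X"
proof -
  have "distorted_expectation M f (\<lambda>\<omega>. exp (- r * T) * X \<omega> - b)
      = exp (- r * T) * distorted_expectation M f X - b" for b
    using distorted_expectation_affine[OF assms, of "exp (- r * T)" "- b"] by simp
  then have "{b. distorted_expectation M f (\<lambda>\<omega>. exp (- r * T) * X \<omega> - b) \<ge> 0}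
      = {..exp (- r * T) * distorted_expectation M f X}" by auto
  then show ?thesis unfolding bid_price_def by simp
qed

text \<open>Here the position is \<open>- X\<close> scaled by the discount factor and shifted by
  \<open>a\<close>, so the affine rule is applied to \<open>- X\<close>.\<close>

lemma ask_price_eq:
  assumes "distortion_function f" "X \<in> L_inf M"
  shows "ask_price M f r T X = - exp (- r * T) * distorted_expectation M f (\<lambda>\<omega>. - X \<omega>)"
proof -
  have X: "(\<lambda>\<omega>. - X \<omega>) \<in> L_inf M" using assms(2) by (auto simp: L_inf_def)
  have "distorted_expectation M f (\<lambda>\<omega>. a - exp (- r * T) * X \<omega>)
      = exp (- r * T) * distorted_expectation M f (\<lambda>\<omega>. - X \<omega>) + a" for a
    using distorted_expectation_affine[OF assms(1) X, of "exp (- r * T)" a] by simp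
  then have "{a. distorted_expectation M f (\<lambda>\<omega>. a - exp (- r * T) * X \<omega>) \<ge> 0}
      = {- exp (- r * T) * distorted_expectation M f (\<lambda>\<omega>. - X \<omega>)..}" by auto
  then show ?thesis unfolding ask_price_def by simp
qed

lemma distorted_expectation_nonneg:
  assumes f: "distortion_function f" and X [measurable]: "X \<in> borel_measurable M"
    and bounds: "AE \<omega> in M. 0 \<le> X \<omega>" "AE \<omega> in M. X \<omega> \<le> B"
  shows "distorted_expectation M f X = (LBINT x:{0..B}. 1 - f (prob {\<omega> \<in> space M. X \<omega> \<le> x}))"
  unfolding distorted_expectation_eq_integral[OF assms] set_lebesgue_integral_def
  by (rule Bochner_Integration.integral_cong)
    (auto split: split_indicator simp: distorted_cdf_eq_0[OF f bounds(1)] distorted_cdf_eq_1[OF f X bounds(2)])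

lemma distorted_expectation_nonpos:
  assumes f: "distortion_function f" and X [measurable]: "X \<in> borel_measurable M"
    and bounds: "AE \<omega> in M. A \<le> X \<omega>" "AE \<omega> in M. X \<omega> \<le> 0"
  shows "distorted_expectation M f X = - (LBINT x:{A..0}. f (prob {\<omega> \<in> space M. X \<omega> \<le> x}))"
proof -
  note [measurable] = borel_measurable_distorted_cdf[OF f X]
  \<comment> \<open>At \<open>x = 0\<close> the left side is 0, whereas the right side can be -1, so
    a null set has to be removed.\<close>
  have "AE x in lborel. indicator {0..} x - f (prob {\<omega> \<in> space M. X \<omega> \<le> x})
      = - (indicator {A..0} x *\<^sub>R f (prob {\<omega> \<in> space M. X \<omega> \<le> x}))"
    using AE_lborel_singleton[of "0::real"]
    by eventually_elim
      (auto split: split_indicator simp: distorted_cdf_eq_0[OF f bounds(1)] distorted_cdf_eq_1[OF f X bounds(2)])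
  then show ?thesis
    unfolding distorted_expectation_eq_integral[OF assms] set_lebesgue_integral_def
      Bochner_Integration.integral_minus[symmetric]
    by (intro integral_cong_AE) auto
qed

section \<open>The put option on a nonnegative price\<close>

text \<open>A probability law has at most countably many atoms.\<close>

lemma AE_lborel_prob_eq_0:
  fixes S :: "'a \<Rightarrow> real"
  assumes [measurable]: "S \<in> borel_measurable M"
  shows "AE y in lborel. prob {\<omega> \<in> space M. S \<omega> = y} = 0"
proof -
  interpret D: prob_space "distr M borel S" by (rule prob_space_distr) simp
  have "measure (distr M borel S) {y} = prob {\<omega> \<in> space M. S \<omega> = y}" for y
    by (subst measure_distr) (auto intro!: arg_cong[where f = prob])
  then show ?thesis
    using D.countable_support by (intro AE_I'[OF countable_imp_null_set_lborel]) auto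
qed

text \<open>After the reflection \<open>x = K - y\<close>, the event that the payoff is at most
  \<open>K - y\<close> becomes \<open>y \<le> S\<close>, whose probability is \<open>1 - F y\<close>
  unless \<open>y\<close> is an atom of \<open>S\<close>. The minus sign arises because
  \<open>1 - F\<close> decreases.\<close>

lemma distorted_expectation_put:
  assumes f: "distortion_function f" and S [measurable]: "S \<in> borel_measurable M"
    and S_nonneg: "AE \<omega> in M. 0 \<le> S \<omega>" and "0 < K"
  defines "F \<equiv> \<lambda>x. prob {\<omega> \<in> space M. S \<omega> \<le> x}"
  shows "distorted_expectation M f (\<lambda>\<omega>. max (K - S \<omega>) 0)
      = - stieltjes_integral 0 K (\<lambda>x. K - x) (\<lambda>x. f (1 - F x))"
proof -
  let ?P = "\<lambda>\<omega>. max (K - S \<omega>) 0"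
  have anti: "antimono (\<lambda>x. f (1 - F x))"
    unfolding F_def by (intro antimonoI distortion_functionD(3)[OF f] diff_left_mono finite_measure_mono) auto
  have "mono (\<lambda>x. - f (1 - F x))" using anti by (auto simp: monotone_def)
  from borel_measurable_uminus[OF borel_measurable_mono[OF this]]
  have [measurable]: "(\<lambda>x. f (1 - F x)) \<in> borel_measurable borel" by simp
  note [measurable] = borel_measurable_distorted_cdf[OF f, of ?P]
  have "f (1 - F x) = 1" if "x < 0" for x
  proof -
    have "F x = 0" unfolding F_def
      by (rule prob_eq_0_AE, use S_nonneg in eventually_elim) (use that in auto)
    then show ?thesis using distortion_functionD(2)[OF f] by simp
  qed
  from stieltjes_integral_antimono_linear[OF anti this, where b = K]
  have *: "- stieltjes_integral 0 K (\<lambda>x. K - x) (\<lambda>x. f (1 - F x)) = (LBINT y:{0..K}. 1 - f (1 - F y))"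
    by simp
  have "distorted_expectation M f ?P = (LBINT x:{0..K}. 1 - f (prob {\<omega> \<in> space M. ?P \<omega> \<le> x}))"
    using S_nonneg \<open>0 < K\<close> by (intro distorted_expectation_nonneg f) (auto elim!: eventually_mono)
  also have "\<dots> = (LBINT y. indicator {0..K} (K - y) * (1 - f (prob {\<omega> \<in> space M. ?P \<omega> \<le> K - y})))"
    unfolding set_lebesgue_integral_def
    by (subst lborel_integral_real_affine[of "-1" _ K]) simp_all
  also have "\<dots> = (LBINT y:{0..K}. 1 - f (1 - F y))"
    unfolding set_lebesgue_integral_def
  proof (rule integral_cong_AE)
    show "AE y in lborel. indicator {0..K} (K - y) * (1 - f (prob {\<omega> \<in> space M. ?P \<omega> \<le> K - y}))
        = indicator {0..K} y *\<^sub>R (1 - f (1 - F y))"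
      using AE_lborel_prob_eq_0[OF S]
    proof eventually_elim
      fix y assume y: "prob {\<omega> \<in> space M. S \<omega> = y} = 0"
      have "prob {\<omega> \<in> space M. ?P \<omega> \<le> K - y} = 1 - F y" if "y \<le> K"
      proof -
        \<comment> \<open>Splitting off \<open>S = y\<close> isolates the possible atom, which has
          probability 0 for the chosen \<open>y\<close>.\<close>
        have "prob {\<omega> \<in> space M. ?P \<omega> \<le> K - y} = prob ({\<omega> \<in> space M. y < S \<omega>} \<union> {\<omega> \<in> space M. S \<omega> = y})"
          using that by (intro arg_cong[where f = prob]) auto
        also have "\<dots> = prob {\<omega> \<in> space M. y < S \<omega>}"
          by (subst finite_measure_Union) (auto simp: y)
        also have "{\<omega> \<in> space M. y < S \<omega>} = space M - {\<omega> \<in> space M. S \<omega> \<le> y}" by auto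
        also have "prob \<dots> = 1 - F y" unfolding F_def by (rule prob_compl) simp
        finally show ?thesis .
      qed
      then show "indicator {0..K} (K - y) * (1 - f (prob {\<omega> \<in> space M. ?P \<omega> \<le> K - y}))
        = indicator {0..K} y *\<^sub>R (1 - f (1 - F y))"
        by (auto split: split_indicator)
    qed
  qed measurable
  finally show ?thesis using * by simp
qed

text \<open>The shift \<open>x = y - K\<close> turns the event into \<open>S \<le> y\<close>
  directly, so atoms of \<open>S\<close> cause no correction.\<close>

lemma distorted_expectation_short_put:
  assumes f: "distortion_function f" and S [measurable]: "S \<in> borel_measurable M"
    and S_nonneg: "AE \<omega> in M. 0 \<le> S \<omega>" and "0 < K"
  defines "F \<equiv> \<lambda>x. prob {\<omega> \<in> space M. S \<omega> \<le> x}"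
  shows "distorted_expectation M f (\<lambda>\<omega>. - max (K - S \<omega>) 0)
      = - stieltjes_integral 0 K (\<lambda>x. K - x) (\<lambda>x. f (F x))"
proof -
  let ?P = "\<lambda>\<omega>. - max (K - S \<omega>) 0"
  have mono: "mono (\<lambda>x. f (F x))" unfolding F_def by (rule mono_distorted_cdf[OF f S])
  note [measurable] = borel_measurable_mono[OF mono] borel_measurable_distorted_cdf[OF f, of ?P]
  have "f (F x) = 0" if "x < 0" for x
    unfolding F_def by (rule distorted_cdf_eq_0[OF f S_nonneg that])
  from stieltjes_integral_mono_linear[OF mono this, where b = K]
  have *: "stieltjes_integral 0 K (\<lambda>x. K - x) (\<lambda>x. f (F x)) = (LBINT y:{0..K}. f (F y))"
    by simp
  have "distorted_expectation M f ?P = - (LBINT x:{- K..0}. f (prob {\<omega> \<in> space M. ?P \<omega> \<le> x}))"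
    using S_nonneg \<open>0 < K\<close> by (intro distorted_expectation_nonpos f) (auto elim!: eventually_mono)
  also have "(LBINT x:{- K..0}. f (prob {\<omega> \<in> space M. ?P \<omega> \<le> x}))
      = (LBINT y. indicator {- K..0} (- K + y) * f (prob {\<omega> \<in> space M. ?P \<omega> \<le> - K + y}))"
    unfolding set_lebesgue_integral_def
    by (subst lborel_integral_real_affine[of 1 _ "- K"]) simp_all
  also have "\<dots> = (LBINT y:{0..K}. f (F y))"
    unfolding set_lebesgue_integral_def
  proof (rule integral_cong_AE)
    show "AE y in lborel. indicator {- K..0} (- K + y) * f (prob {\<omega> \<in> space M. ?P \<omega> \<le> - K + y})
        = indicator {0..K} y *\<^sub>R f (F y)"
      \<comment> \<open>At \<open>y = K\<close> the event is certain, because the negated payoff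
        never exceeds 0, while \<open>F K\<close> may be less than 1.\<close>
      using AE_lborel_singleton[of K]
    proof eventually_elim
      fix y assume "y \<noteq> K"
      then have "prob {\<omega> \<in> space M. ?P \<omega> \<le> - K + y} = F y" if "y \<le> K"
        unfolding F_def using that by (intro arg_cong[where f = prob]) auto
      then show "indicator {- K..0} (- K + y) * f (prob {\<omega> \<in> space M. ?P \<omega> \<le> - K + y})
        = indicator {0..K} y *\<^sub>R f (F y)"
        by (auto split: split_indicator)
    qed
  qed measurable
  finally show ?thesis using * by simp
qed

end

section \<open>Nonnegativity of the price\<close>

text \<open>The existential form matches the set comprehensions in
  \<open>independent_families\<close>.\<close>

lemma cylinder_event:
  fixes Z :: "'i \<Rightarrow> 'a \<Rightarrow> 'c::topological_space"
  assumes "i \<in> I" and [measurable]: "D \<in> sets borel"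
  shows "\<exists>C. {\<omega> \<in> space M. Z i \<omega> \<in> D} = (\<lambda>\<omega>. \<lambda>j\<in>I. Z j \<omega>) -` C \<inter> space M
    \<and> C \<in> sets (Pi\<^sub>M I (\<lambda>_. borel))"
proof (intro exI conjI)
  show "{z \<in> space (Pi\<^sub>M I (\<lambda>_. borel)). z i \<in> D} \<in> sets (Pi\<^sub>M I (\<lambda>_. borel))"
    using \<open>i \<in> I\<close> by measurable
qed (use \<open>i \<in> I\<close> in \<open>auto simp: space_PiM\<close>)

lemma (in prob_space) prob_independent_families:
  assumes "independent_families M I X I' Y" and "i \<in> I" "j \<in> I'"
    and [measurable]: "A \<in> sets borel" "B \<in> sets borel"
  shows "prob {\<omega> \<in> space M. X i \<omega> \<in> A \<and> Y j \<omega> \<in> B}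
       = prob {\<omega> \<in> space M. X i \<omega> \<in> A} * prob {\<omega> \<in> space M. Y j \<omega> \<in> B}"
proof -
  have indep: "indep_set
       {(\<lambda>\<omega>. \<lambda>i\<in>I. X i \<omega>) -` A \<inter> space M | A. A \<in> sets (Pi\<^sub>M I (\<lambda>_. borel))}
       {(\<lambda>\<omega>. \<lambda>j\<in>I'. Y j \<omega>) -` A \<inter> space M | A. A \<in> sets (Pi\<^sub>M I' (\<lambda>_. borel))}"
    using assms(1) by (simp add: independent_families_def)
  have "{\<omega> \<in> space M. X i \<omega> \<in> A \<and> Y j \<omega> \<in> B} = {\<omega> \<in> space M. X i \<omega> \<in> A} \<inter> {\<omega> \<in> space M. Y j \<omega> \<in> B}"
    by auto
  moreover have "prob ({\<omega> \<in> space M. X i \<omega> \<in> A} \<inter> {\<omega> \<in> space M. Y j \<omega> \<in> B})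
       = prob {\<omega> \<in> space M. X i \<omega> \<in> A} * prob {\<omega> \<in> space M. Y j \<omega> \<in> B}"
    using cylinder_event[OF assms(2,4), of M X] cylinder_event[OF assms(3,5), of M Y]
    by (intro indep_setD[OF indep]) auto
  ultimately show ?thesis by simp
qed

text \<open>The density is positive everywhere, so a set of probability 0 is Lebesgue null, which
  \<open>B\<close> is not because it contains an interval of positive length.\<close>

lemma (in prob_space) normal_prob_pos:
  assumes X: "distributed M lborel X (normal_density m s)" and "0 < s" and B: "B \<in> sets borel"
    and "u < v" "{u<..<v} \<subseteq> B"
  shows "0 < prob {\<omega> \<in> space M. X \<omega> \<in> B}"
proof (rule ccontr)
  assume "\<not> ?thesis"
  then have "prob {\<omega> \<in> space M. X \<omega> \<in> B} = 0" by (simp add: zero_less_measure_iff)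
  moreover have "{\<omega> \<in> space M. X \<omega> \<in> B} = X -` B \<inter> space M" by auto
  ultimately have "emeasure M (X -` B \<inter> space M) = 0" by (simp add: emeasure_eq_measure)
  then have "(\<integral>\<^sup>+x. ennreal (normal_density m s x) * indicator B x \<partial>lborel) = 0"
    using distributed_emeasure[OF X, of B] B by simp
  then have "AE x in lborel. ennreal (normal_density m s x) * indicator B x = 0"
    using B by (subst (asm) nn_integral_0_iff_AE) auto
  then have "AE x in lborel. x \<notin> B"
    by eventually_elim
      (use normal_density_pos[OF \<open>0 < s\<close>, of m] in \<open>auto simp: ennreal_eq_0_iff not_le[symmetric]\<close>)
  then have "B \<in> null_sets lborel" using B by (subst (asm) AE_iff_null_sets[symmetric]) auto
  moreover have "emeasure lborel {u<..<v} \<le> emeasure lborel B"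
    using \<open>{u<..<v} \<subseteq> B\<close> B by (intro emeasure_mono) auto
  ultimately show False using \<open>u < v\<close> by (auto simp: null_sets_def)
qed

lemma (in prob_space) normal_mult_unbounded:
  assumes X: "distributed M lborel X (normal_density m s)" and "0 < s" and "c \<noteq> 0"
  shows "0 < prob {\<omega> \<in> space M. a < c * X \<omega>}"
proof (cases "0 < c")
  case True
  have "{\<omega> \<in> space M. a < c * X \<omega>} = {\<omega> \<in> space M. X \<omega> \<in> {a / c<..}}"
    using True by (auto simp: field_simps)
  then show ?thesis using normal_prob_pos[OF X \<open>0 < s\<close>, of "{a / c<..}" "a / c" "a / c + 1"] by (simp add: subset_eq)
next
  case False
  then have "{\<omega> \<in> space M. a < c * X \<omega>} = {\<omega> \<in> space M. X \<omega> \<in> {..<a / c}}"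
    using \<open>c \<noteq> 0\<close> by (auto simp: field_simps)
  then show ?thesis using normal_prob_pos[OF X \<open>0 < s\<close>, of "{..<a / c}" "a / c - 1" "a / c"] by (simp add: subset_eq)
qed

text \<open>A one-element index set with coefficient 1 extracts the marginal at \<open>t\<close>.
  The constant alternative of \<open>gaussian_rv\<close> is excluded by the positive variance
  \<open>t powr (2 * H)\<close>.\<close>

lemma (in prob_space) fractional_brownian_motion_normal:
  assumes X: "fractional_brownian_motion M H X" and "0 < t"
  obtains m s where "0 < s" "distributed M lborel (X t) (normal_density m s)"
proof -
  have "gaussian_rv M (\<lambda>\<omega>. \<Sum>u\<in>{t}. 1 * X u \<omega>)"
    using X \<open>0 < t\<close> unfolding fractional_brownian_motion_def gaussian_process_def
    by (elim conjE allE[of _ "{t}"] allE[of _ "\<lambda>_. 1"] impE) auto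
  then have "gaussian_rv M (X t)" by simp
  moreover have False if "AE \<omega> in M. X t \<omega> = m" for m
  proof -
    have mean: "(LINT \<omega>|M. X t \<omega>) = 0"
      and "covariance M (X t) (X t) = (\<bar>t\<bar> powr (2 * H) + \<bar>t\<bar> powr (2 * H) - \<bar>t - t\<bar> powr (2 * H)) / 2"
      using X \<open>0 < t\<close> less_imp_le unfolding fractional_brownian_motion_def by blast+
    then have cov: "covariance M (X t) (X t) = t powr (2 * H)" using \<open>0 < t\<close> by simp
    have [measurable]: "X t \<in> borel_measurable M"
      using \<open>gaussian_rv M (X t)\<close> by (simp add: gaussian_rv_def)
    have "(LINT \<omega>|M. X t \<omega>) = (LINT \<omega>|M. m)"
      by (rule integral_cong_AE) (use that in auto)
    then have "m = 0" using mean prob_space by simp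
    have "(LINT \<omega>|M. X t \<omega> * X t \<omega>) = (LINT \<omega>|M. m * m)"
      by (rule integral_cong_AE) (use that in auto)
    then have "covariance M (X t) (X t) = 0"
      unfolding covariance_def using mean \<open>m = 0\<close> by simp
    with cov \<open>0 < t\<close> show False by simp
  qed
  ultimately show ?thesis unfolding gaussian_rv_def using that by blast
qed

text \<open>The law is given for increments, and the process starts at 0 only almost surely, so the
  increment from time 0 is replaced by \<open>X t\<close> up to a null set.\<close>

lemma (in prob_space) standard_brownian_motion_normal:
  assumes X: "standard_brownian_motion M X" and "0 < t"
  shows "distributed M lborel (X t) (normal_density 0 (sqrt t))"
proof -
  have "distributed M lborel (\<lambda>\<omega>. X t \<omega> - X 0 \<omega>) (normal_density 0 (sqrt (t - 0)))"
    and X0: "AE \<omega> in M. X 0 \<omega> = 0"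
    and [measurable]: "X t \<in> borel_measurable M" "X 0 \<in> borel_measurable M"
    using X \<open>0 < t\<close>[THEN less_imp_le] \<open>0 < t\<close> unfolding standard_brownian_motion_def
    by (blast intro: order_refl)+
  moreover have "distr M lborel (\<lambda>\<omega>. X t \<omega> - X 0 \<omega>) = distr M lborel (X t)"
    by (rule distr_cong_AE) (use X0 in auto)
  ultimately show ?thesis unfolding distributed_def by simp
qed

lemma (in prob_space) mixed_gaussian_unbounded:
  assumes W: "standard_brownian_motion M W" and WH: "fractional_brownian_motion M H WH"
    and indep: "independent_families M {0..} W {0..} WH"
    and "(\<sigma>, \<epsilon>) \<noteq> (0, 0)" and "0 < t"
  shows "0 < prob {\<omega> \<in> space M. a < \<sigma> * W t \<omega> + \<epsilon> * WH t \<omega>}"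
proof -
  obtain m s where WH_normal: "0 < s" "distributed M lborel (WH t) (normal_density m s)"
    using fractional_brownian_motion_normal[OF WH \<open>0 < t\<close>] .
  note W_normal = standard_brownian_motion_normal[OF W \<open>0 < t\<close>]
  have [measurable]: "W t \<in> borel_measurable M" "WH t \<in> borel_measurable M"
    using indep \<open>0 < t\<close> by (auto simp: independent_families_def)
  have part: "0 < prob {\<omega> \<in> space M. b < c * X \<omega>}"
    if "c \<noteq> 0 \<or> b < 0" "0 < s'" "distributed M lborel X (normal_density m' s')"
    for b c X m' s'
  proof (cases "c = 0")
    case True
    then have "{\<omega> \<in> space M. b < c * X \<omega>} = space M" using that by auto
    then show ?thesis by (simp add: prob_space)
  qed (use that normal_mult_unbounded in auto)
  \<comment> \<open>One threshold is -1, so that its event is certain if the matching coefficient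
    vanishes; the threshold \<open>a + 1\<close> goes to a coefficient known to be nonzero.\<close>
  obtain u v where "u + v = a" "\<sigma> \<noteq> 0 \<or> u < 0" "\<epsilon> \<noteq> 0 \<or> v < 0"
  proof (cases "\<sigma> = 0")
    case True
    then show ?thesis using that[of "- 1" "a + 1"] assms(4) by auto
  next
    case False
    then show ?thesis using that[of "a + 1" "- 1"] by auto
  qed
  then have "0 < prob {\<omega> \<in> space M. u < \<sigma> * W t \<omega>} * prob {\<omega> \<in> space M. v < \<epsilon> * WH t \<omega>}"
    using part[OF _ _ W_normal] part[OF _ WH_normal] \<open>0 < t\<close> by simp
  also have "\<dots> = prob {\<omega> \<in> space M. u < \<sigma> * W t \<omega> \<and> v < \<epsilon> * WH t \<omega>}"
    using prob_independent_families[OF indep, of t t "{x. u < \<sigma> * x}" "{x. v < \<epsilon> * x}"] \<open>0 < t\<close>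
    by simp
  also have "\<dots> \<le> prob {\<omega> \<in> space M. a < \<sigma> * W t \<omega> + \<epsilon> * WH t \<omega>}"
    using \<open>u + v = a\<close> by (intro finite_measure_mono) auto
  finally show ?thesis .
qed

text \<open>The jump factor is not assumed nonnegative. If it were negative with positive probability,
  its independent lognormal cofactor would make the product unbounded below.\<close>

lemma (in prob_space) AE_nonneg_of_bounded_below_product:
  fixes Y :: "'i \<Rightarrow> 'a \<Rightarrow> real" and V :: "'j \<Rightarrow> 'a \<Rightarrow> 'c::topological_space"
  assumes indep: "independent_families M I Y I' V" and "i \<in> I" "j \<in> I'"
    and [measurable]: "h \<in> borel_measurable borel"
    and unbounded: "\<And>a. 0 < prob {\<omega> \<in> space M. a < h (V j \<omega>)}"
    and bounded_below: "AE \<omega> in M. - C \<le> h (V j \<omega>) * Y i \<omega>"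
  shows "AE \<omega> in M. 0 \<le> Y i \<omega>"
proof -
  have [measurable]: "Y i \<in> borel_measurable M" "V j \<in> borel_measurable M"
    using assms(1-3) by (auto simp: independent_families_def)
  \<comment> \<open>Negative values are treated in levels bounded away from 0; a large cofactor can
    push the product below \<open>- C\<close> only uniformly on such a level.\<close>
  have "AE \<omega> in M. - 1 / real (Suc n) \<le> Y i \<omega>" for n
  proof -
    \<comment> \<open>A cofactor above this value times a \<open>Y i\<close> below
      \<open>- 1 / real (Suc n)\<close> is less than \<open>- \<bar>C\<bar>\<close>, contradicting
      the lower bound.\<close>
    let ?a = "\<bar>C\<bar> * real (Suc n)"
    have "prob {\<omega> \<in> space M. Y i \<omega> < - 1 / real (Suc n) \<and> ?a < h (V j \<omega>)} = 0"
    proof (rule prob_eq_0_AE, use bounded_below in eventually_elim)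
      fix \<omega> assume C: "- C \<le> h (V j \<omega>) * Y i \<omega>"
      show "\<not> (Y i \<omega> < - 1 / real (Suc n) \<and> ?a < h (V j \<omega>))"
      proof
        assume *: "Y i \<omega> < - 1 / real (Suc n) \<and> ?a < h (V j \<omega>)"
        then have "0 < h (V j \<omega>)" using order_le_less_trans[of 0 ?a] by simp
        have "\<bar>C\<bar> = ?a * (1 / real (Suc n))" by simp
        also have "\<dots> < h (V j \<omega>) * (1 / real (Suc n))"
          using * by (intro mult_strict_right_mono) auto
        also have "\<dots> < h (V j \<omega>) * (- Y i \<omega>)"
          using * \<open>0 < h (V j \<omega>)\<close> by (intro mult_strict_left_mono) auto
        finally show False using C by simp
      qed
    qed
    moreover have "{y. y < - 1 / real (Suc n)} \<in> sets borel" "{v. ?a < h v} \<in> sets borel"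
      by measurable
    ultimately have "prob {\<omega> \<in> space M. Y i \<omega> < - 1 / real (Suc n)} * prob {\<omega> \<in> space M. ?a < h (V j \<omega>)} = 0"
      using prob_independent_families[OF indep assms(2,3), of "{y. y < - 1 / real (Suc n)}" "{v. ?a < h v}"]
      by simp
    then have "prob {\<omega> \<in> space M. Y i \<omega> < - 1 / real (Suc n)} = 0"
      using unbounded[of ?a] by simp
    then have "AE \<omega> in M. \<not> Y i \<omega> < - 1 / real (Suc n)"
      by (subst (asm) prob_eq_0) auto
    then show ?thesis by (auto simp: not_less)
  qed
  then have "AE \<omega> in M. \<forall>n. - 1 / real (Suc n) \<le> Y i \<omega>" by (simp add: AE_all_countable)
  then show ?thesis
  proof eventually_elim
    fix \<omega> assume *: "\<forall>n. - 1 / real (Suc n) \<le> Y i \<omega>"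
    show "0 \<le> Y i \<omega>"
    proof (rule ccontr)
      assume "\<not> 0 \<le> Y i \<omega>"
      then obtain n where "inverse (real (Suc n)) < - Y i \<omega>"
        using reals_Archimedean[of "- Y i \<omega>"] by auto
      with *[rule_format, of n] show False by (simp add: inverse_eq_divide)
    qed
  qed
qed

theorem mainTheorem2:
  fixes M :: "'a measure"
    and W WH :: "real \<Rightarrow> 'a \<Rightarrow> real"
    and N :: "real \<Rightarrow> 'a \<Rightarrow> nat"
    and J :: "nat \<Rightarrow> 'a \<Rightarrow> real"
    and S0 r T K H \<sigma> \<epsilon> rate \<gamma> :: real
    and f :: "real \<Rightarrow> real \<Rightarrow> real"
    and S_tilde S_T payoff :: "'a \<Rightarrow> real"
    and F :: "real \<Rightarrow> real"
  assumes "prob_space M"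
    and "S0 > 0" and "T > 0" and "K > 0"
    and "3/4 < H" and "H \<le> 1"
    and "(\<sigma>, \<epsilon>) \<noteq> (0, 0)"
    and "rate > 0"
    and "distortion_class f" and "\<gamma> \<ge> 0"
    and "standard_brownian_motion M W"
    and "fractional_brownian_motion M H WH"
    and "independent_families M {0..} W {0..} WH"
    and "poisson_process M rate N"
    and "iid_sequence M J"
    and "independent_families M {1..} J {1..} (jump_time N)"
    and "independent_families M {0..} (jump_factor N J) {0..} (\<lambda>t \<omega>. (W t \<omega>, WH t \<omega>))"
    and S_tilde: "\<And>\<omega>. S_tilde \<omega> =
          S0 * exp (r * T + \<sigma> * W T \<omega> + \<epsilon> * WH T \<omega>
                    - 1/2 * \<sigma>^2 * T - 1/2 * \<epsilon>^2 * T powr (2 * H))"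
    and S_T: "\<And>\<omega>. S_T \<omega> = S_tilde \<omega> * jump_factor N J T \<omega>"
    and F: "\<And>x. F x = measure M {\<omega> \<in> space M. S_T \<omega> \<le> x}"
    and payoff: "\<And>\<omega>. payoff \<omega> = max (K - S_T \<omega>) 0"
    and "payoff \<in> L_inf M"
  shows "bid_price M (f \<gamma>) r T payoff
           = exp (- r * T) * distorted_expectation M (f \<gamma>) payoff
       \<and> exp (- r * T) * distorted_expectation M (f \<gamma>) payoff
           = - exp (- r * T) * stieltjes_integral 0 K (\<lambda>x. K - x) (\<lambda>x. f \<gamma> (1 - F x))
       \<and> - exp (- r * T) * stieltjes_integral 0 K (\<lambda>x. K - x) (\<lambda>x. f \<gamma> (1 - F x))
           = - exp (- r * T) * stieltjes_integral 0 K (\<lambda>x. K) (\<lambda>x. f \<gamma> (1 - F x))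
             + exp (- r * T) * stieltjes_integral 0 K (\<lambda>x. x) (\<lambda>x. f \<gamma> (1 - F x))
       \<and> ask_price M (f \<gamma>) r T payoff
           = - exp (- r * T) * distorted_expectation M (f \<gamma>) (\<lambda>\<omega>. - payoff \<omega>)
       \<and> - exp (- r * T) * distorted_expectation M (f \<gamma>) (\<lambda>\<omega>. - payoff \<omega>)
           = exp (- r * T) * stieltjes_integral 0 K (\<lambda>x. K - x) (\<lambda>x. f \<gamma> (F x))
       \<and> exp (- r * T) * stieltjes_integral 0 K (\<lambda>x. K - x) (\<lambda>x. f \<gamma> (F x))
           = exp (- r * T) * stieltjes_integral 0 K (\<lambda>x. K) (\<lambda>x. f \<gamma> (F x))
             - exp (- r * T) * stieltjes_integral 0 K (\<lambda>x. x) (\<lambda>x. f \<gamma> (F x))"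
proof -
  interpret prob_space M by fact
  note indep_W = \<open>independent_families M {0..} W {0..} WH\<close>
  note indep_J = \<open>independent_families M {0..} (jump_factor N J) {0..} (\<lambda>t \<omega>. (W t \<omega>, WH t \<omega>))\<close>
  have f: "distortion_function (f \<gamma>)"
    using \<open>distortion_class f\<close> \<open>\<gamma> \<ge> 0\<close> by (simp add: distortion_class_def)
  have [measurable]: "W T \<in> borel_measurable M" "WH T \<in> borel_measurable M"
    "jump_factor N J T \<in> borel_measurable M"
    using indep_W indep_J \<open>T > 0\<close> by (auto simp: independent_families_def)
  have S [measurable]: "S_T \<in> borel_measurable M"
    unfolding S_T[abs_def] S_tilde by measurable

  \<comment> \<open>Collecting the deterministic drift in \<open>d\<close> exhibits
    \<open>S_tilde\<close> as a Borel function \<open>h\<close> of the pair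
    \<open>(W T, WH T)\<close>, the form in which independence of the jump factor is
    available.\<close>
  define d where "d = r * T - 1/2 * \<sigma>^2 * T - 1/2 * \<epsilon>^2 * T powr (2 * H)"
  define h where "h = (\<lambda>(w, w'). S0 * exp (\<sigma> * w + \<epsilon> * w' + d))"
  have h_eq: "h (W T \<omega>, WH T \<omega>) = S_tilde \<omega>" for \<omega>
    unfolding h_def d_def S_tilde by (simp add: algebra_simps)
  have [measurable]: "h \<in> borel_measurable borel"
    unfolding h_def case_prod_beta by (intro borel_measurable_continuous_onI continuous_intros)
  obtain C where C: "AE \<omega> in M. \<bar>payoff \<omega>\<bar> \<le> C"
    using \<open>payoff \<in> L_inf M\<close> by (auto simp: L_inf_def)
  have "AE \<omega> in M. 0 \<le> jump_factor N J T \<omega>"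
  proof (rule AE_nonneg_of_bounded_below_product[OF indep_J])
    \<comment> \<open>The payoff dominates \<open>K - S_T\<close>, so its bound \<open>C\<close>
      gives \<open>S_T \<ge> K - C\<close>.\<close>
    show "AE \<omega> in M. - (C - K) \<le> h (W T \<omega>, WH T \<omega>) * jump_factor N J T \<omega>"
      using C by eventually_elim (simp add: payoff h_eq S_T[symmetric])
    fix a
    \<comment> \<open>Beyond this threshold \<open>h\<close> exceeds
      \<open>\<bar>a\<bar> + 1\<close>; using this in place of \<open>a\<close> keeps the argument
      of the logarithm positive.\<close>
    have "0 < prob {\<omega> \<in> space M. ln ((\<bar>a\<bar> + 1) / S0) - d < \<sigma> * W T \<omega> + \<epsilon> * WH T \<omega>}"
      by (rule mixed_gaussian_unbounded) fact+
    also have "\<dots> \<le> prob {\<omega> \<in> space M. a < h (W T \<omega>, WH T \<omega>)}"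
    proof (rule finite_measure_mono)
      show "{\<omega> \<in> space M. ln ((\<bar>a\<bar> + 1) / S0) - d < \<sigma> * W T \<omega> + \<epsilon> * WH T \<omega>}
        \<subseteq> {\<omega> \<in> space M. a < h (W T \<omega>, WH T \<omega>)}"
      proof safe
        fix \<omega> assume "ln ((\<bar>a\<bar> + 1) / S0) - d < \<sigma> * W T \<omega> + \<epsilon> * WH T \<omega>"
        then have "exp (ln ((\<bar>a\<bar> + 1) / S0)) < exp (\<sigma> * W T \<omega> + \<epsilon> * WH T \<omega> + d)" by simp
        then have "\<bar>a\<bar> + 1 < h (W T \<omega>, WH T \<omega>)"
          using \<open>S0 > 0\<close> by (simp add: h_def field_simps add_pos_nonneg)
        then show "a < h (W T \<omega>, WH T \<omega>)" by simp
      qed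
    qed (simp add: h_eq S_tilde)
    finally show "0 < prob {\<omega> \<in> space M. a < h (W T \<omega>, WH T \<omega>)}" .
  qed (use \<open>T > 0\<close> in auto)
  then have S_nonneg: "AE \<omega> in M. 0 \<le> S_T \<omega>"
    by eventually_elim (use \<open>S0 > 0\<close> in \<open>simp add: S_T S_tilde\<close>)

  have payoff_eq: "payoff = (\<lambda>\<omega>. max (K - S_T \<omega>) 0)" and F_eq: "F = (\<lambda>x. prob {\<omega> \<in> space M. S_T \<omega> \<le> x})"
    using payoff F by auto
  have mono: "mono (\<lambda>x. f \<gamma> (F x))"
    unfolding F_eq by (rule mono_distorted_cdf[OF f S])
  have anti: "antimono (\<lambda>x. f \<gamma> (1 - F x))"
    unfolding F_eq
    by (intro antimonoI distortion_functionD(3)[OF f] diff_left_mono finite_measure_mono) auto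
  have linear: "stieltjes_integral 0 K (\<lambda>x. K - x) g
      = stieltjes_integral 0 K (\<lambda>x. K) g - stieltjes_integral 0 K (\<lambda>x. x) g"
    if "mono g \<or> antimono g" for g
    using that by (intro stieltjes_integral_diff continuous_intros)
  note L = \<open>payoff \<in> L_inf M\<close>
  have put': "distorted_expectation M (f \<gamma>) payoff
      = - stieltjes_integral 0 K (\<lambda>x. K - x) (\<lambda>x. f \<gamma> (1 - F x))"
    using distorted_expectation_put[OF f S S_nonneg \<open>K > 0\<close>] unfolding payoff_eq F_eq .
  have short_put': "distorted_expectation M (f \<gamma>) (\<lambda>\<omega>. - payoff \<omega>)
      = - stieltjes_integral 0 K (\<lambda>x. K - x) (\<lambda>x. f \<gamma> (F x))"
    using distorted_expectation_short_put[OF f S S_nonneg \<open>K > 0\<close>] unfolding payoff_eq F_eq .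
  show ?thesis
    unfolding bid_price_eq[OF f L] ask_price_eq[OF f L] put' short_put'
      linear[OF disjI1[OF mono]] linear[OF disjI2[OF anti]]
    by (simp add: algebra_simps)
qed

end
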